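(* Let $\mathbb{C}$ be a unital category in which a morphism is a monomorphism if and only if its kernel is $0$. Let $k:X\to A$ and $l:Y\to A$ be Bourn-normal monomorphisms in $\mathbb{C}$ with the same codomain. If $k$ and $l$ have trivial pullback (i.e. $X\times_A Y\cong 0$), then $k$ and $l$ Huq-commute.
   Context: In a pointed category, $0$ denotes the zero object and also every zero morphism. A category is unital if it is pointed, finitely complete, and for all objects $X,Y$ the morphisms $\langle 1,0\rangle:X\to X\times Y$ and $\langle 0,1\rangle:Y\to X\times Y$ are jointly strongly epimorphic. Morphisms $f:X\to A$ and $g:Y\to A$ in a unital category Huq-commute (or simply commute) if there is a (necessarily unique) morphism $\varphi:X\times Y\to A$ with $\varphi\langle 1,0\rangle=f$ and $\varphi\langle 0,1\rangle=g$. A monomorphism $k:X\to A$ in a pointed finitely complete category is Bourn-normal if it is the zero class of an internal equivalence relation, i.e. there are an equivalence relation $r_1,r_2:R\to A$ and a morphism $\kappa:X\to R$ such that $\langle r_1,r_2\rangle\kappa=\langle 1,0\rangle k$ and this square is a pullback (of $\langle r_1,r_2\rangle:R\to A\times A$ along $\langle 1,0\rangle:A\to A\times A$). *)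

theory Defs
  imports Main
begin

record ('o, 'a) cat =
  Ob :: "'o set"
  Ar :: "'a set"
  Dom :: "'a \<Rightarrow> 'o"
  Cod :: "'a \<Rightarrow> 'o"
  ident :: "'o \<Rightarrow> 'a"
  comp :: "'a \<Rightarrow> 'a \<Rightarrow> 'a"  (infixl "\<cdot>\<index>" 70)  (* \<open>g \<cdot> f\<close> is "first f, then g" *)

definition Hom :: "('o, 'a) cat \<Rightarrow> 'o \<Rightarrow> 'o \<Rightarrow> 'a set" where
  "Hom C X Y = {f \<in> Ar C. Dom C f = X \<and> Cod C f = Y}"

locale category =
  fixes C :: "('o, 'a) cat" (structure)
  assumes Dom_closed: "f \<in> Ar C \<Longrightarrow> Dom C f \<in> Ob C"
    and Cod_closed: "f \<in> Ar C \<Longrightarrow> Cod C f \<in> Ob C"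
    and ident_closed: "X \<in> Ob C \<Longrightarrow> ident C X \<in> Hom C X X"
    and comp_closed: "f \<in> Hom C X Y \<Longrightarrow> g \<in> Hom C Y Z \<Longrightarrow> g \<cdot> f \<in> Hom C X Z"
    and ident_left: "f \<in> Hom C X Y \<Longrightarrow> ident C Y \<cdot> f = f"
    and ident_right: "f \<in> Hom C X Y \<Longrightarrow> f \<cdot> ident C X = f"
    and comp_assoc: "f \<in> Hom C W X \<Longrightarrow> g \<in> Hom C X Y \<Longrightarrow> h \<in> Hom C Y Z
      \<Longrightarrow> (h \<cdot> g) \<cdot> f = h \<cdot> (g \<cdot> f)"

definition is_functor ::
    "('i, 'u) cat \<Rightarrow> ('o, 'a) cat \<Rightarrow> ('i \<Rightarrow> 'o) \<Rightarrow> ('u \<Rightarrow> 'a) \<Rightarrow> bool" where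
  "is_functor J C Fo Fa \<longleftrightarrow>
     (\<forall>i\<in>Ob J. Fo i \<in> Ob C) \<and>
     (\<forall>u\<in>Ar J. Fa u \<in> Hom C (Fo (Dom J u)) (Fo (Cod J u))) \<and>
     (\<forall>i\<in>Ob J. Fa (ident J i) = ident C (Fo i)) \<and>
     (\<forall>u\<in>Ar J. \<forall>v\<in>Ar J. Cod J u = Dom J v \<longrightarrow> Fa (v \<cdot>\<^bsub>J\<^esub> u) = Fa v \<cdot>\<^bsub>C\<^esub> Fa u)"

definition is_cone ::
    "('i, 'u) cat \<Rightarrow> ('o, 'a) cat \<Rightarrow> ('i \<Rightarrow> 'o) \<Rightarrow> ('u \<Rightarrow> 'a) \<Rightarrow> 'o \<Rightarrow> ('i \<Rightarrow> 'a) \<Rightarrow> bool" where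
  "is_cone J C Fo Fa L c \<longleftrightarrow>
     L \<in> Ob C \<and>
     (\<forall>i\<in>Ob J. c i \<in> Hom C L (Fo i)) \<and>
     (\<forall>u\<in>Ar J. Fa u \<cdot>\<^bsub>C\<^esub> c (Dom J u) = c (Cod J u))"

definition is_limit ::
    "('i, 'u) cat \<Rightarrow> ('o, 'a) cat \<Rightarrow> ('i \<Rightarrow> 'o) \<Rightarrow> ('u \<Rightarrow> 'a) \<Rightarrow> 'o \<Rightarrow> ('i \<Rightarrow> 'a) \<Rightarrow> bool" where
  "is_limit J C Fo Fa L c \<longleftrightarrow>
     is_cone J C Fo Fa L c \<and>
     (\<forall>M d. is_cone J C Fo Fa M d \<longrightarrow>
        (\<exists>!h. h \<in> Hom C M L \<and> (\<forall>i\<in>Ob J. c i \<cdot>\<^bsub>C\<^esub> h = d i)))"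

text \<open>Index categories may be taken over \<open>nat\<close>, since every finite category is isomorphic
  to one whose objects and arrows are natural numbers.\<close>

definition finitely_complete :: "('o, 'a) cat \<Rightarrow> bool" where
  "finitely_complete C \<longleftrightarrow>
     (\<forall>(J :: (nat, nat) cat) Fo Fa.
        category J \<and> finite (Ob J) \<and> finite (Ar J) \<and> is_functor J C Fo Fa \<longrightarrow>
        (\<exists>L c. is_limit J C Fo Fa L c))"

definition zero_object :: "('o, 'a) cat \<Rightarrow> 'o \<Rightarrow> bool" where
  "zero_object C Z \<longleftrightarrow>
     Z \<in> Ob C \<and> (\<forall>X\<in>Ob C. (\<exists>!f. f \<in> Hom C X Z) \<and> (\<exists>!f. f \<in> Hom C Z X))"

definition pointed :: "('o, 'a) cat \<Rightarrow> bool" where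
  "pointed C \<longleftrightarrow> (\<exists>Z. zero_object C Z)"

text \<open>Well defined in any pointed category: the morphism factoring through a zero object is
  unique and does not depend on the zero object.\<close>

definition zero_mor :: "('o, 'a) cat \<Rightarrow> 'o \<Rightarrow> 'o \<Rightarrow> 'a" where
  "zero_mor C X Y =
     (THE f. \<exists>Z g h. zero_object C Z \<and> g \<in> Hom C X Z \<and> h \<in> Hom C Z Y \<and> f = h \<cdot>\<^bsub>C\<^esub> g)"

definition monic :: "('o, 'a) cat \<Rightarrow> 'a \<Rightarrow> bool" where
  "monic C m \<longleftrightarrow>
     m \<in> Ar C \<and>
     (\<forall>W. \<forall>u\<in>Hom C W (Dom C m). \<forall>v\<in>Hom C W (Dom C m).
        m \<cdot>\<^bsub>C\<^esub> u = m \<cdot>\<^bsub>C\<^esub> v \<longrightarrow> u = v)"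

definition is_kernel :: "('o, 'a) cat \<Rightarrow> 'a \<Rightarrow> 'a \<Rightarrow> bool" where
  "is_kernel C f k \<longleftrightarrow>
     f \<in> Ar C \<and> k \<in> Ar C \<and> Cod C k = Dom C f \<and>
     f \<cdot>\<^bsub>C\<^esub> k = zero_mor C (Dom C k) (Cod C f) \<and>
     (\<forall>W. \<forall>g\<in>Hom C W (Dom C f). f \<cdot>\<^bsub>C\<^esub> g = zero_mor C W (Cod C f) \<longrightarrow>
        (\<exists>!h. h \<in> Hom C W (Dom C k) \<and> k \<cdot>\<^bsub>C\<^esub> h = g))"

definition is_product :: "('o, 'a) cat \<Rightarrow> 'o \<Rightarrow> 'o \<Rightarrow> 'o \<Rightarrow> 'a \<Rightarrow> 'a \<Rightarrow> bool" where
  "is_product C X Y P p q \<longleftrightarrow>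
     P \<in> Ob C \<and> p \<in> Hom C P X \<and> q \<in> Hom C P Y \<and>
     (\<forall>W. \<forall>f\<in>Hom C W X. \<forall>g\<in>Hom C W Y.
        \<exists>!h. h \<in> Hom C W P \<and> p \<cdot>\<^bsub>C\<^esub> h = f \<and> q \<cdot>\<^bsub>C\<^esub> h = g)"

text \<open>The morphism \<open>\<langle>f, g\<rangle>\<close> into the product with projections \<open>p\<close> and \<open>q\<close>.\<close>

definition pairing :: "('o, 'a) cat \<Rightarrow> 'a \<Rightarrow> 'a \<Rightarrow> 'a \<Rightarrow> 'a \<Rightarrow> 'a" where
  "pairing C p q f g =
     (THE h. h \<in> Hom C (Dom C f) (Dom C p) \<and> p \<cdot>\<^bsub>C\<^esub> h = f \<and> q \<cdot>\<^bsub>C\<^esub> h = g)"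

text \<open>\<open>\<langle>1, 0\<rangle> : X \<rightarrow> X \<times> Y\<close> and \<open>\<langle>0, 1\<rangle> : Y \<rightarrow> X \<times> Y\<close>.\<close>

definition inj1 :: "('o, 'a) cat \<Rightarrow> 'o \<Rightarrow> 'o \<Rightarrow> 'a \<Rightarrow> 'a \<Rightarrow> 'a" where
  "inj1 C X Y p q = pairing C p q (ident C X) (zero_mor C X Y)"

definition inj2 :: "('o, 'a) cat \<Rightarrow> 'o \<Rightarrow> 'o \<Rightarrow> 'a \<Rightarrow> 'a \<Rightarrow> 'a" where
  "inj2 C X Y p q = pairing C p q (zero_mor C Y X) (ident C Y)"

text \<open>\<open>p\<close> and \<open>q\<close> are the projections of a pullback of \<open>f\<close> and \<open>g\<close>: \<open>f \<cdot> p = g \<cdot> q\<close>.\<close>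

definition is_pullback :: "('o, 'a) cat \<Rightarrow> 'a \<Rightarrow> 'a \<Rightarrow> 'a \<Rightarrow> 'a \<Rightarrow> bool" where
  "is_pullback C f g p q \<longleftrightarrow>
     f \<in> Ar C \<and> g \<in> Ar C \<and> Cod C f = Cod C g \<and>
     p \<in> Hom C (Dom C p) (Dom C f) \<and> q \<in> Hom C (Dom C p) (Dom C g) \<and>
     f \<cdot>\<^bsub>C\<^esub> p = g \<cdot>\<^bsub>C\<^esub> q \<and>
     (\<forall>W. \<forall>u\<in>Hom C W (Dom C f). \<forall>v\<in>Hom C W (Dom C g).
        f \<cdot>\<^bsub>C\<^esub> u = g \<cdot>\<^bsub>C\<^esub> v \<longrightarrow>
        (\<exists>!h. h \<in> Hom C W (Dom C p) \<and> p \<cdot>\<^bsub>C\<^esub> h = u \<and> q \<cdot>\<^bsub>C\<^esub> h = v))"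

text \<open>Jointly epimorphic, and jointly orthogonal to monomorphisms. Uniqueness of the diagonal
  \<open>d\<close>, and the equations \<open>d \<cdot> f = u\<close> and \<open>d \<cdot> g = v\<close>, follow from \<open>m\<close> being a monomorphism.\<close>

definition jointly_strongly_epic :: "('o, 'a) cat \<Rightarrow> 'a \<Rightarrow> 'a \<Rightarrow> bool" where
  "jointly_strongly_epic C f g \<longleftrightarrow>
     f \<in> Ar C \<and> g \<in> Ar C \<and> Cod C f = Cod C g \<and>
     (\<forall>W. \<forall>s\<in>Hom C (Cod C f) W. \<forall>t\<in>Hom C (Cod C f) W.
        s \<cdot>\<^bsub>C\<^esub> f = t \<cdot>\<^bsub>C\<^esub> f \<and> s \<cdot>\<^bsub>C\<^esub> g = t \<cdot>\<^bsub>C\<^esub> g \<longrightarrow> s = t) \<and>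
     (\<forall>m. \<forall>u\<in>Hom C (Dom C f) (Dom C m). \<forall>v\<in>Hom C (Dom C g) (Dom C m).
        \<forall>h\<in>Hom C (Cod C f) (Cod C m).
        monic C m \<and> m \<cdot>\<^bsub>C\<^esub> u = h \<cdot>\<^bsub>C\<^esub> f \<and> m \<cdot>\<^bsub>C\<^esub> v = h \<cdot>\<^bsub>C\<^esub> g \<longrightarrow>
        (\<exists>d\<in>Hom C (Cod C f) (Dom C m). m \<cdot>\<^bsub>C\<^esub> d = h))"

definition unital :: "('o, 'a) cat \<Rightarrow> bool" where
  "unital C \<longleftrightarrow>
     category C \<and> pointed C \<and> finitely_complete C \<and>
     (\<forall>X\<in>Ob C. \<forall>Y\<in>Ob C. \<forall>P p q. is_product C X Y P p q \<longrightarrow>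
        jointly_strongly_epic C (inj1 C X Y p q) (inj2 C X Y p q))"

text \<open>The choice of the product is immaterial, as products are unique up to isomorphism.\<close>

definition huq_commute :: "('o, 'a) cat \<Rightarrow> 'a \<Rightarrow> 'a \<Rightarrow> bool" where
  "huq_commute C f g \<longleftrightarrow>
     f \<in> Ar C \<and> g \<in> Ar C \<and> Cod C f = Cod C g \<and>
     (\<exists>P p q. is_product C (Dom C f) (Dom C g) P p q \<and>
        (\<exists>\<phi>\<in>Hom C P (Cod C f).
           \<phi> \<cdot>\<^bsub>C\<^esub> inj1 C (Dom C f) (Dom C g) p q = f \<and>
           \<phi> \<cdot>\<^bsub>C\<^esub> inj2 C (Dom C f) (Dom C g) p q = g))"

text \<open>In the transitivity clause \<open>Dom C p\<close> is the object of composable pairs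
  \<open>((a, b), (b, c))\<close>, which \<open>t\<close> sends to \<open>(a, c)\<close>.\<close>

definition equivalence_relation ::
    "('o, 'a) cat \<Rightarrow> 'o \<Rightarrow> 'o \<Rightarrow> 'a \<Rightarrow> 'a \<Rightarrow> bool" where
  "equivalence_relation C A R r1 r2 \<longleftrightarrow>
     A \<in> Ob C \<and> R \<in> Ob C \<and> r1 \<in> Hom C R A \<and> r2 \<in> Hom C R A \<and>
     (\<forall>W. \<forall>u\<in>Hom C W R. \<forall>v\<in>Hom C W R.
        r1 \<cdot>\<^bsub>C\<^esub> u = r1 \<cdot>\<^bsub>C\<^esub> v \<and> r2 \<cdot>\<^bsub>C\<^esub> u = r2 \<cdot>\<^bsub>C\<^esub> v \<longrightarrow> u = v) \<and>
     (\<exists>e\<in>Hom C A R. r1 \<cdot>\<^bsub>C\<^esub> e = ident C A \<and> r2 \<cdot>\<^bsub>C\<^esub> e = ident C A) \<and>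
     (\<exists>s\<in>Hom C R R. r1 \<cdot>\<^bsub>C\<^esub> s = r2 \<and> r2 \<cdot>\<^bsub>C\<^esub> s = r1) \<and>
     (\<exists>p q. is_pullback C r2 r1 p q \<and>
        (\<exists>t\<in>Hom C (Dom C p) R. r1 \<cdot>\<^bsub>C\<^esub> t = r1 \<cdot>\<^bsub>C\<^esub> p \<and> r2 \<cdot>\<^bsub>C\<^esub> t = r2 \<cdot>\<^bsub>C\<^esub> q))"

definition bourn_normal :: "('o, 'a) cat \<Rightarrow> 'a \<Rightarrow> bool" where
  "bourn_normal C k \<longleftrightarrow>
     monic C k \<and>
     (\<exists>R r1 r2 \<kappa> P p q.
        equivalence_relation C (Cod C k) R r1 r2 \<and>
        \<kappa> \<in> Hom C (Dom C k) R \<and>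
        is_product C (Cod C k) (Cod C k) P p q \<and>
        is_pullback C (pairing C p q r1 r2) (inj1 C (Cod C k) (Cod C k) p q) \<kappa> k)"

end

theory Submission
  imports Defs
begin

text \<open>In terms of elements, let \<open>R\<close> and \<open>S\<close> be equivalence relations on \<open>A\<close> with zero
  classes \<open>X\<close> and \<open>Y\<close>, and let \<open>D = {(x, y, a) | a R y, a S x}\<close>. The kernel of the projection
  \<open>D \<rightarrow> X \<times> Y\<close> consists of the \<open>a\<close> with \<open>a R 0\<close> and \<open>a S 0\<close>, so it is the trivial pullback of
  \<open>X\<close> and \<open>Y\<close>, and the projection is a monomorphism. Both injections factor through it,
  by \<open>(x, 0, x)\<close> and \<open>(0, y, y)\<close>, so unitality yields a section \<open>X \<times> Y \<rightarrow> D\<close>, whose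
  composite with \<open>(x, y, a) \<mapsto> a\<close> is the required morphism.\<close>

section \<open>Pullbacks and binary products from finite limits\<close>

definition cospan :: "(nat, nat) cat" where
  "cospan = \<lparr>Ob = {0, 1, 2}, Ar = {0, 1, 2, 3, 4},
     Dom = (\<lambda>u. if u = 3 then 0 else if u = 4 then 1 else u),
     Cod = (\<lambda>u. if u = 3 \<or> u = 4 then 2 else u),
     ident = (\<lambda>i. i), comp = (\<lambda>g f. if f = 3 \<or> f = 4 then f else g)\<rparr>"

text \<open>Arrows 0, 1, 2 are the identities; 3 and 4 are the two legs into object 2 and do not
  compose with each other. Every composable pair thus contains an identity, and \<open>comp\<close>
  returns the other arrow.\<close>

lemma category_cospan: "category cospan"
  by unfold_locales (auto simp: cospan_def Hom_def split: if_splits)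

context category
begin

lemma HomD: "f \<in> Hom C X Y \<Longrightarrow> f \<in> Ar C \<and> Dom C f = X \<and> Cod C f = Y \<and> X \<in> Ob C \<and> Y \<in> Ob C"
  using Dom_closed Cod_closed by (auto simp: Hom_def)

lemma pullback_exists:
  assumes fc: "finitely_complete C" and f: "f \<in> Hom C X Z" and g: "g \<in> Hom C Y Z"
  shows "\<exists>p q. is_pullback C f g p q"
proof -
  \<comment> \<open>The diagram sends legs 3 and 4 of \<open>cospan\<close> to \<open>f\<close> and
    \<open>g\<close>.\<close>
  define Fo where "Fo = (\<lambda>i::nat. if i = 0 then X else if i = 1 then Y else Z)"
  define Fa where "Fa = (\<lambda>u::nat. if u = 3 then f else if u = 4 then g else ident C (Fo u))"
  note fg = HomD[OF f] HomD[OF g]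
  have J: "Ob cospan = {0, 1, 2}" "Ar cospan = {0, 1, 2, 3, 4}"
    by (simp_all add: cospan_def)
  have id_comp: "ident C W \<cdot> ident C W = ident C W" if "W \<in> Ob C" for W
    using that by (meson ident_closed ident_left)
  have "is_functor cospan C Fo Fa"
    using fg f g ident_closed ident_left ident_right id_comp
    by (auto simp: is_functor_def cospan_def Fo_def Fa_def)
  then obtain L c where "is_limit cospan C Fo Fa L c"
    using fc category_cospan unfolding finitely_complete_def by (metis J finite.emptyI finite_insert)
  then have cone: "is_cone cospan C Fo Fa L c"
    and univ: "\<And>M d. is_cone cospan C Fo Fa M d \<Longrightarrow>
      \<exists>!h. h \<in> Hom C M L \<and> (\<forall>i\<in>Ob cospan. c i \<cdot> h = d i)"
    unfolding is_limit_def by blast+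
  have c: "c 0 \<in> Hom C L X" "c 1 \<in> Hom C L Y" "f \<cdot> c 0 = c 2" "g \<cdot> c 1 = c 2"
    using cone by (auto simp: is_cone_def cospan_def Fo_def Fa_def)
  have "is_pullback C f g (c 0) (c 1)"
    unfolding is_pullback_def
  proof (intro conjI allI ballI impI)
    fix W u v
    assume "u \<in> Hom C W (Dom C f)" "v \<in> Hom C W (Dom C g)" and eq: "f \<cdot> u = g \<cdot> v"
    then have u: "u \<in> Hom C W X" and v: "v \<in> Hom C W Y"
      using fg by auto
    \<comment> \<open>The leg over the corner is the common composite
      \<open>f \<cdot> u = g \<cdot> v\<close>.\<close>
    define d where "d = (\<lambda>i::nat. if i = 0 then u else if i = 1 then v else f \<cdot> u)"
    have fu: "f \<cdot> u \<in> Hom C W Z" using u f by (rule comp_closed)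
    have "is_cone cospan C Fo Fa W d"
      using HomD[OF u] u v eq fu by (auto simp: is_cone_def cospan_def Fo_def Fa_def d_def ident_left)
    from univ[OF this]
    have ex: "\<exists>!h. h \<in> Hom C W L \<and> c 0 \<cdot> h = u \<and> c 1 \<cdot> h = v \<and> c 2 \<cdot> h = f \<cdot> u"
      by (simp add: J d_def)
    \<comment> \<open>A pullback demands uniqueness among maps matching two legs only; the third
      equation is automatic because \<open>c 2 = f \<cdot> c 0\<close>.\<close>
    have "c 2 \<cdot> h = f \<cdot> u" if "h \<in> Hom C W L" "c 0 \<cdot> h = u" for h
      using that c f comp_assoc by metis
    with ex show "\<exists>!h. h \<in> Hom C W (Dom C (c 0)) \<and> c 0 \<cdot> h = u \<and> c 1 \<cdot> h = v"
      using HomD[OF c(1)] by metis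
  qed (use c fg in \<open>auto simp: Hom_def\<close>)
  then show ?thesis by blast
qed

text \<open>A product is a pullback over a zero object, where every square commutes.\<close>

lemma product_exists:
  assumes fc: "finitely_complete C" and "pointed C" and X: "X \<in> Ob C" and Y: "Y \<in> Ob C"
  shows "\<exists>P p q. is_product C X Y P p q"
proof -
  obtain Z where Z: "zero_object C Z"
    using \<open>pointed C\<close> unfolding pointed_def by blast
  then obtain f g where f: "f \<in> Hom C X Z" and g: "g \<in> Hom C Y Z"
    using X Y unfolding zero_object_def by metis
  obtain p q where pq: "is_pullback C f g p q"
    using pullback_exists[OF fc f g] by blast
  have "f \<cdot> u = g \<cdot> v" if u: "u \<in> Hom C W X" and v: "v \<in> Hom C W Y" for W u v
    using Z HomD[OF u] comp_closed[OF u f] comp_closed[OF v g] unfolding zero_object_def by metis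
  then have "is_product C X Y (Dom C p) p q"
    using pq HomD[OF f] HomD[OF g] HomD[of p]
    unfolding is_pullback_def is_product_def by metis
  then show ?thesis by blast
qed

lemma pairing:
  assumes "is_product C X Y P p q" "f \<in> Hom C W X" "g \<in> Hom C W Y"
  shows "pairing C p q f g \<in> Hom C W P"
    and "p \<cdot> pairing C p q f g = f" and "q \<cdot> pairing C p q f g = g"
proof -
  have "\<exists>!h. h \<in> Hom C W P \<and> p \<cdot> h = f \<and> q \<cdot> h = g"
    using assms unfolding is_product_def by blast
  \<comment> \<open>\<open>pairing\<close> reads its source and target off \<open>Dom C f\<close>
    and \<open>Dom C p\<close>; these must be identified before the description can be
    evaluated.\<close>
  moreover have "Dom C f = W" "Dom C p = P"
    using assms HomD unfolding is_product_def by blast+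
  ultimately have "pairing C p q f g \<in> Hom C W P \<and> p \<cdot> pairing C p q f g = f
      \<and> q \<cdot> pairing C p q f g = g"
    unfolding pairing_def using theI'[of "\<lambda>h. h \<in> Hom C W P \<and> p \<cdot> h = f \<and> q \<cdot> h = g"] by simp
  then show "pairing C p q f g \<in> Hom C W P"
    and "p \<cdot> pairing C p q f g = f" and "q \<cdot> pairing C p q f g = g" by auto
qed

lemma product_ext:
  assumes "is_product C X Y P p q" "f \<in> Hom C W P" "g \<in> Hom C W P"
    and "p \<cdot> f = p \<cdot> g" "q \<cdot> f = q \<cdot> g"
  shows "f = g"
proof -
  have "p \<cdot> g \<in> Hom C W X" "q \<cdot> g \<in> Hom C W Y"
    using assms comp_closed unfolding is_product_def by blast+
  then show ?thesis using assms unfolding is_product_def by metis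
qed

lemma pullback_ext:
  assumes "is_pullback C f g p q" "u \<in> Hom C W (Dom C p)" "v \<in> Hom C W (Dom C p)"
    and "p \<cdot> u = p \<cdot> v" "q \<cdot> u = q \<cdot> v"
  shows "u = v"
proof -
  have p: "p \<in> Hom C (Dom C p) (Dom C f)" and q: "q \<in> Hom C (Dom C p) (Dom C g)"
    and f: "f \<in> Hom C (Dom C f) (Cod C f)" and g: "g \<in> Hom C (Dom C g) (Cod C f)"
    and eq: "f \<cdot> p = g \<cdot> q"
    using assms(1) unfolding is_pullback_def Hom_def by auto
  have pv: "p \<cdot> v \<in> Hom C W (Dom C f)" and qv: "q \<cdot> v \<in> Hom C W (Dom C g)"
    using assms(3) p q comp_closed by blast+
  have "f \<cdot> (p \<cdot> v) = g \<cdot> (q \<cdot> v)"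
    using comp_assoc[OF assms(3) p f] comp_assoc[OF assms(3) q g] eq by simp
  then have "\<exists>!h. h \<in> Hom C W (Dom C p) \<and> p \<cdot> h = p \<cdot> v \<and> q \<cdot> h = q \<cdot> v"
    using assms(1) pv qv unfolding is_pullback_def by blast
  then show ?thesis using assms(2-5) by metis
qed

end

section \<open>Zero morphisms, kernels and zero classes\<close>

locale pointed_category = category +
  assumes pointed: "pointed C"
begin

text \<open>Two factorisations through zero objects are linked by a map \<open>t\<close> between
  those objects; both triangles commute by uniqueness of maps into and out of a zero object.\<close>

lemma zero_mor_eq:
  assumes Z: "zero_object C Z" and g: "g \<in> Hom C X Z" and h: "h \<in> Hom C Z Y"
  shows "zero_mor C X Y = h \<cdot> g"
  unfolding zero_mor_def
proof (rule the_equality)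
  show "\<exists>Z g' h'. zero_object C Z \<and> g' \<in> Hom C X Z \<and> h' \<in> Hom C Z Y \<and> h \<cdot> g = h' \<cdot> g'"
    using assms by blast
next
  fix f assume "\<exists>Z g h. zero_object C Z \<and> g \<in> Hom C X Z \<and> h \<in> Hom C Z Y \<and> f = h \<cdot> g"
  then obtain Z' g' h' where Z': "zero_object C Z'" and g': "g' \<in> Hom C X Z'"
    and h': "h' \<in> Hom C Z' Y" and f: "f = h' \<cdot> g'" by blast
  obtain t where t: "t \<in> Hom C Z Z'"
    using Z Z' unfolding zero_object_def by metis
  have "t \<cdot> g = g'"
    using comp_closed[OF g t] g' Z' HomD[OF g] unfolding zero_object_def by metis
  moreover have "h' \<cdot> t = h"
    using comp_closed[OF t h'] h Z HomD[OF h] unfolding zero_object_def by metis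
  ultimately show "f = h \<cdot> g"
    using f comp_assoc[OF g t h'] by simp
qed

lemma zero_factors:
  assumes "X \<in> Ob C" "Y \<in> Ob C"
  obtains Z g h where "zero_object C Z" "g \<in> Hom C X Z" "h \<in> Hom C Z Y" "zero_mor C X Y = h \<cdot> g"
proof -
  obtain Z where Z: "zero_object C Z"
    using pointed unfolding pointed_def by blast
  then have "\<exists>!g. g \<in> Hom C X Z" "\<exists>!h. h \<in> Hom C Z Y"
    using assms unfolding zero_object_def by auto
  then obtain g h where g: "g \<in> Hom C X Z" and h: "h \<in> Hom C Z Y"
    by (elim ex1E)
  show thesis
    by (rule that[OF Z g h zero_mor_eq[OF Z g h]])
qed

lemma zero_closed: "X \<in> Ob C \<Longrightarrow> Y \<in> Ob C \<Longrightarrow> zero_mor C X Y \<in> Hom C X Y"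
  by (erule (1) zero_factors) (simp add: comp_closed)

lemma comp_zero:
  assumes "W \<in> Ob C" and f: "f \<in> Hom C X Y"
  shows "f \<cdot> zero_mor C W X = zero_mor C W Y"
proof -
  obtain Z g h where Z: "zero_object C Z" "g \<in> Hom C W Z" "h \<in> Hom C Z X"
    "zero_mor C W X = h \<cdot> g"
    using zero_factors[of W X] assms HomD[OF f] by blast
  then show ?thesis
    using zero_mor_eq[OF Z(1,2) comp_closed[OF Z(3) f]] comp_assoc[OF Z(2,3) f] by simp
qed

lemma zero_comp:
  assumes "Y \<in> Ob C" and f: "f \<in> Hom C W X"
  shows "zero_mor C X Y \<cdot> f = zero_mor C W Y"
proof -
  obtain Z g h where Z: "zero_object C Z" "g \<in> Hom C X Z" "h \<in> Hom C Z Y"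
    "zero_mor C X Y = h \<cdot> g"
    using zero_factors[of X Y] assms HomD[OF f] by blast
  then show ?thesis
    using zero_mor_eq[OF Z(1) comp_closed[OF f Z(2)] Z(3)] comp_assoc[OF f Z(2,3)] by simp
qed

text \<open>This brings the kernel criterion for monomorphisms into a form that can be tested on
  generalized elements. The kernel is the map \<open>n\<close> from a zero object.\<close>

lemma zero_kernel:
  assumes f: "f \<in> Hom C X Y"
    and triv: "\<And>W g. g \<in> Hom C W X \<Longrightarrow> f \<cdot> g = zero_mor C W Y \<Longrightarrow> g = zero_mor C W X"
  shows "\<exists>n. is_kernel C f n \<and> zero_object C (Dom C n)"
proof -
  obtain Z where Z: "zero_object C Z"
    using pointed unfolding pointed_def by blast
  note Xf = HomD[OF f]
  obtain n where n: "n \<in> Hom C Z X"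
    using Z Xf unfolding zero_object_def by metis
  have idZ: "ident C Z \<in> Hom C Z Z"
    using Z ident_closed unfolding zero_object_def by blast
  \<comment> \<open>\<open>n\<close> composed with the identity of \<open>Z\<close> is a
    factorisation through a zero object.\<close>
  have "n = zero_mor C Z X"
    using zero_mor_eq[OF Z idZ n] ident_right[OF n] by simp
  then have "f \<cdot> n = zero_mor C Z Y"
    using comp_zero[OF _ f] HomD[OF n] by simp
  moreover have "\<exists>!h. h \<in> Hom C W Z \<and> n \<cdot> h = g"
    if g: "g \<in> Hom C W X" "f \<cdot> g = zero_mor C W Y" for W g
  proof -
    have "\<exists>!h. h \<in> Hom C W Z"
      using Z HomD[OF g(1)] unfolding zero_object_def by blast
    then show ?thesis
      using triv[OF g] zero_mor_eq[OF Z _ n] by metis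
  qed
  ultimately have "is_kernel C f n"
    using Xf HomD[OF n] unfolding is_kernel_def by simp
  then show ?thesis using Z HomD[OF n] by auto
qed

lemma inj1:
  assumes "is_product C X Y P p q" "X \<in> Ob C" "Y \<in> Ob C"
  shows "inj1 C X Y p q \<in> Hom C X P" "p \<cdot> inj1 C X Y p q = ident C X"
    "q \<cdot> inj1 C X Y p q = zero_mor C X Y"
  unfolding inj1_def using pairing[OF assms(1) ident_closed zero_closed] assms by auto

lemma inj2:
  assumes "is_product C X Y P p q" "X \<in> Ob C" "Y \<in> Ob C"
  shows "inj2 C X Y p q \<in> Hom C Y P" "p \<cdot> inj2 C X Y p q = zero_mor C Y X"
    "q \<cdot> inj2 C X Y p q = ident C Y"
  unfolding inj2_def using pairing[OF assms(1) zero_closed ident_closed] assms by auto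

text \<open>A reflexive relation \<open>\<langle>r1, r2\<rangle>\<close> on \<open>A\<close> for which \<open>k : X \<rightarrow> A\<close> is the class \<open>{a | (a, 0) \<in> R}\<close>.\<close>

definition zero_class_of where
  "zero_class_of X A k R r1 r2 \<longleftrightarrow>
     r1 \<in> Hom C R A \<and> r2 \<in> Hom C R A \<and>
     (\<forall>W. \<forall>u\<in>Hom C W R. \<forall>v\<in>Hom C W R. r1 \<cdot> u = r1 \<cdot> v \<and> r2 \<cdot> u = r2 \<cdot> v \<longrightarrow> u = v) \<and>
     (\<exists>e\<in>Hom C A R. r1 \<cdot> e = ident C A \<and> r2 \<cdot> e = ident C A) \<and>
     (\<exists>\<kappa>\<in>Hom C X R. r1 \<cdot> \<kappa> = k \<and> r2 \<cdot> \<kappa> = zero_mor C X A) \<and>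
     (\<forall>W. \<forall>u\<in>Hom C W R. r2 \<cdot> u = zero_mor C W A \<longrightarrow> (\<exists>x\<in>Hom C W X. k \<cdot> x = r1 \<cdot> u))"

text \<open>The components of the pullback square say that \<open>\<kappa>\<close> is the pair
  \<open>(k, 0)\<close>; its universal property says that every pair \<open>(a, 0)\<close> in the
  relation comes from \<open>X\<close>.\<close>

lemma bourn_normal_zero_class:
  assumes k: "k \<in> Hom C X A" and "bourn_normal C k"
  shows "\<exists>R r1 r2. zero_class_of X A k R r1 r2"
proof -
  note kA = HomD[OF k]
  obtain R r1 r2 \<kappa> P p q where eq: "equivalence_relation C A R r1 r2"
    and \<kappa>: "\<kappa> \<in> Hom C X R" and prod: "is_product C A A P p q"
    and pb: "is_pullback C (pairing C p q r1 r2) (inj1 C A A p q) \<kappa> k"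
    using assms kA unfolding bourn_normal_def by auto
  have r1: "r1 \<in> Hom C R A" and r2: "r2 \<in> Hom C R A"
    using eq unfolding equivalence_relation_def by auto
  have p: "p \<in> Hom C P A" and q: "q \<in> Hom C P A"
    using prod unfolding is_product_def by auto
  let ?r = "pairing C p q r1 r2" and ?i = "inj1 C A A p q"
  note r = pairing[OF prod r1 r2] and i = inj1[OF prod]
  have i': "?i \<in> Hom C A P" "p \<cdot> ?i = ident C A" "q \<cdot> ?i = zero_mor C A A"
    using i kA by auto
  have sq: "?r \<cdot> \<kappa> = ?i \<cdot> k"
    using pb unfolding is_pullback_def by auto
  have "r1 \<cdot> \<kappa> = p \<cdot> (?r \<cdot> \<kappa>)"
    using comp_assoc[OF \<kappa> r(1) p] r(2) by simp
  also have "\<dots> = k"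
    using sq comp_assoc[OF k i'(1) p] i'(2) ident_left[OF k] by simp
  finally have k1: "r1 \<cdot> \<kappa> = k" .
  have "r2 \<cdot> \<kappa> = q \<cdot> (?r \<cdot> \<kappa>)"
    using comp_assoc[OF \<kappa> r(1) q] r(3) by simp
  also have "\<dots> = zero_mor C X A"
    using sq comp_assoc[OF k i'(1) q] i'(3) zero_comp[OF _ k] kA by simp
  finally have k2: "r2 \<cdot> \<kappa> = zero_mor C X A" .
  have cls: "\<exists>x. x \<in> Hom C W X \<and> k \<cdot> x = r1 \<cdot> u"
    if u: "u \<in> Hom C W R" and z: "r2 \<cdot> u = zero_mor C W A" for W u
  proof -
    have ru: "r1 \<cdot> u \<in> Hom C W A" using u r1 by (rule comp_closed)
    \<comment> \<open>With second component zero, \<open>u\<close> is the pair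
      \<open>(r1 \<cdot> u, 0)\<close>, so it agrees with \<open>\<langle>1, 0\<rangle>\<close>
      applied to \<open>r1 \<cdot> u\<close>. The map induced into the pullback is the required
      \<open>x\<close>.\<close>
    have "?r \<cdot> u = ?i \<cdot> (r1 \<cdot> u)"
    proof (rule product_ext[OF prod comp_closed[OF u r(1)] comp_closed[OF ru i'(1)]])
      show "p \<cdot> (?r \<cdot> u) = p \<cdot> (?i \<cdot> (r1 \<cdot> u))"
        using comp_assoc[OF u r(1) p] comp_assoc[OF ru i'(1) p] r(2) i'(2) ident_left[OF ru]
        by simp
      show "q \<cdot> (?r \<cdot> u) = q \<cdot> (?i \<cdot> (r1 \<cdot> u))"
        using comp_assoc[OF u r(1) q] comp_assoc[OF ru i'(1) q] r(3) i'(3) zero_comp[OF _ ru] z kA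
        by simp
    qed
    moreover have "u \<in> Hom C W (Dom C ?r)" "r1 \<cdot> u \<in> Hom C W (Dom C ?i)" "Dom C \<kappa> = X"
      using u ru HomD[OF r(1)] HomD[OF i'(1)] HomD[OF \<kappa>] by auto
    ultimately show ?thesis
      using pb unfolding is_pullback_def by metis
  qed
  have "zero_class_of X A k R r1 r2"
    unfolding zero_class_of_def
  proof (intro conjI)
    show "\<exists>\<kappa>\<in>Hom C X R. r1 \<cdot> \<kappa> = k \<and> r2 \<cdot> \<kappa> = zero_mor C X A"
      using \<kappa> k1 k2 by blast
    show "\<forall>W. \<forall>u\<in>Hom C W R. r2 \<cdot> u = zero_mor C W A \<longrightarrow> (\<exists>x\<in>Hom C W X. k \<cdot> x = r1 \<cdot> u)"
      using cls by blast
  qed (use eq in \<open>simp_all add: equivalence_relation_def\<close>)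
  then show ?thesis by blast
qed

end

theorem corollary3p11:
  fixes C :: "('o, 'a) cat"
    and X Y A :: 'o
    and k l p q :: 'a
  assumes "unital C"
    and "\<And>f n. is_kernel C f n \<Longrightarrow> monic C f \<longleftrightarrow> zero_object C (Dom C n)"
    and "k \<in> Hom C X A" and "l \<in> Hom C Y A"
    and "bourn_normal C k" and "bourn_normal C l"
    and "is_pullback C k l p q" and "zero_object C (Dom C p)"
  shows "huq_commute C k l"
proof -
  note k = assms(3) and l = assms(4)
  have cat: "category C" and pt: "pointed C" and fc: "finitely_complete C"
    using assms(1) unfolding unital_def by auto
  interpret category C by (fact cat)
  interpret pointed_category C by unfold_locales (fact pt)
  note kl = HomD[OF k] HomD[OF l]
  obtain R r1 r2 where R: "zero_class_of X A k R r1 r2"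
    using bourn_normal_zero_class[OF k assms(5)] by blast
  have r1: "r1 \<in> Hom C R A" and r2: "r2 \<in> Hom C R A"
    using R unfolding zero_class_of_def by blast+
  have Rmono: "u = v"
    if "u \<in> Hom C W R" "v \<in> Hom C W R" "comp C r1 u = comp C r1 v"
      "comp C r2 u = comp C r2 v" for W u v
    using R that unfolding zero_class_of_def by blast
  obtain d where d: "d \<in> Hom C A R" "comp C r1 d = ident C A" "comp C r2 d = ident C A"
    using R unfolding zero_class_of_def by blast
  obtain \<kappa> where \<kappa>: "\<kappa> \<in> Hom C X R" "comp C r1 \<kappa> = k"
      "comp C r2 \<kappa> = zero_mor C X A"
    using R unfolding zero_class_of_def by blast
  have Rcls: "\<exists>x. x \<in> Hom C W X \<and> comp C k x = comp C r1 u"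
    if "u \<in> Hom C W R" "comp C r2 u = zero_mor C W A" for W u
    using R that unfolding zero_class_of_def by blast
  obtain S s1 s2 where S: "zero_class_of Y A l S s1 s2"
    using bourn_normal_zero_class[OF l assms(6)] by blast
  have s1: "s1 \<in> Hom C S A" and s2: "s2 \<in> Hom C S A"
    using S unfolding zero_class_of_def by blast+
  have Smono: "u = v"
    if "u \<in> Hom C W S" "v \<in> Hom C W S" "comp C s1 u = comp C s1 v"
      "comp C s2 u = comp C s2 v" for W u v
    using S that unfolding zero_class_of_def by blast
  obtain e where e: "e \<in> Hom C A S" "comp C s1 e = ident C A" "comp C s2 e = ident C A"
    using S unfolding zero_class_of_def by blast
  obtain \<mu> where \<mu>: "\<mu> \<in> Hom C Y S" "comp C s1 \<mu> = l"
      "comp C s2 \<mu> = zero_mor C Y A"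
    using S unfolding zero_class_of_def by blast
  have Scls: "\<exists>y. y \<in> Hom C W Y \<and> comp C l y = comp C s1 u"
    if "u \<in> Hom C W S" "comp C s2 u = zero_mor C W A" for W u
    using S that unfolding zero_class_of_def by blast

  \<comment> \<open>Construction of \<open>D\<close> and its projection to the product\<close>
  obtain y \<rho> where pb1: "is_pullback C l r2 y \<rho>" using pullback_exists[OF fc l r2] by blast
  obtain x \<sigma> where pb2: "is_pullback C k s2 x \<sigma>" using pullback_exists[OF fc k s2] by blast
  \<comment> \<open>Elements of \<open>M\<close> are pairs \<open>(y, \<rho>)\<close> with
    \<open>\<rho> = (a, y)\<close> in \<open>R\<close>; elements of \<open>N\<close> are pairs
    \<open>(x, \<sigma>)\<close> with \<open>\<sigma> = (a, x)\<close> in \<open>S\<close>.\<close>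
  define M N where "M = Dom C y" and "N = Dom C x"
  have y: "y \<in> Hom C M Y" and \<rho>: "\<rho> \<in> Hom C M R" and sq1: "comp C l y = comp C r2 \<rho>"
    using pb1 kl HomD[OF r2] unfolding is_pullback_def M_def by auto
  have x: "x \<in> Hom C N X" and \<sigma>: "\<sigma> \<in> Hom C N S" and sq2: "comp C k x = comp C s2 \<sigma>"
    using pb2 kl HomD[OF s2] unfolding is_pullback_def N_def by auto
  note aM = comp_closed[OF \<rho> r1] and aN = comp_closed[OF \<sigma> s1]
  \<comment> \<open>\<open>D\<close> glues \<open>M\<close> and \<open>N\<close> along the common
    first component \<open>a\<close>.\<close>
  obtain m n where pb3: "is_pullback C (comp C r1 \<rho>) (comp C s1 \<sigma>) m n"
    using pullback_exists[OF fc aM aN] by blast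
  define D where "D = Dom C m"
  have m: "m \<in> Hom C D M" and n: "n \<in> Hom C D N"
    and sq3: "comp C (comp C r1 \<rho>) m = comp C (comp C s1 \<sigma>) n"
    using pb3 HomD[OF aM] HomD[OF aN] unfolding is_pullback_def D_def by auto
  obtain P p1 p2 where prod: "is_product C X Y P p1 p2"
    using product_exists[OF fc pt] kl by blast
  have p1: "p1 \<in> Hom C P X" and p2: "p2 \<in> Hom C P Y"
    using prod unfolding is_product_def by auto
  note xn = comp_closed[OF n x] and ym = comp_closed[OF m y]
  define j where "j = pairing C p1 p2 (comp C x n) (comp C y m)"
  have j: "j \<in> Hom C D P" "comp C p1 j = comp C x n" "comp C p2 j = comp C y m"
    unfolding j_def using pairing[OF prod xn ym] by auto

  \<comment> \<open>The existence halves of the three universal properties, by which elements of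
    \<open>D\<close> are built from components.\<close>
  have into_M: "\<exists>h. h \<in> Hom C W M \<and> comp C y h = u \<and> comp C \<rho> h = v"
    if "u \<in> Hom C W Y" "v \<in> Hom C W R" "comp C l u = comp C r2 v" for W u v
    using pb1 that kl HomD[OF r2] unfolding is_pullback_def M_def by metis
  have into_N: "\<exists>h. h \<in> Hom C W N \<and> comp C x h = u \<and> comp C \<sigma> h = v"
    if "u \<in> Hom C W X" "v \<in> Hom C W S" "comp C k u = comp C s2 v" for W u v
    using pb2 that kl HomD[OF s2] unfolding is_pullback_def N_def by metis
  have into_D: "\<exists>h. h \<in> Hom C W D \<and> comp C m h = u \<and> comp C n h = v"
    if "u \<in> Hom C W M" "v \<in> Hom C W N"
      "comp C (comp C r1 \<rho>) u = comp C (comp C s1 \<sigma>) v" for W u v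
    using pb3 that HomD[OF aM] HomD[OF aN] unfolding is_pullback_def D_def by metis

  \<comment> \<open>The projection \<open>j\<close> is a monomorphism\<close>
  have triv: "g = zero_mor C W D" if g: "g \<in> Hom C W D" and jg: "comp C j g = zero_mor C W P" for W g
  proof -
    note WD = HomD[OF g]
    note mg = comp_closed[OF g m] and ng = comp_closed[OF g n]
    note \<rho>g = comp_closed[OF mg \<rho>] and \<sigma>g = comp_closed[OF ng \<sigma>]
    have xg: "comp C x (comp C n g) = zero_mor C W X"
      using comp_assoc[OF g n x] comp_assoc[OF g j(1) p1] j(2) jg comp_zero[OF _ p1] WD by simp
    have yg: "comp C y (comp C m g) = zero_mor C W Y"
      using comp_assoc[OF g m y] comp_assoc[OF g j(1) p2] j(3) jg comp_zero[OF _ p2] WD by simp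
    have r2g: "comp C r2 (comp C \<rho> (comp C m g)) = zero_mor C W A"
      using comp_assoc[OF mg \<rho> r2] comp_assoc[OF mg y l] sq1 yg comp_zero[OF _ l] WD by simp
    have s2g: "comp C s2 (comp C \<sigma> (comp C n g)) = zero_mor C W A"
      using comp_assoc[OF ng \<sigma> s2] comp_assoc[OF ng x k] sq2 xg comp_zero[OF _ k] WD by simp
    \<comment> \<open>Both expressions are the component \<open>a\<close> of \<open>g\<close>, seen
      through \<open>R\<close> and through \<open>S\<close>.\<close>
    have same: "comp C r1 (comp C \<rho> (comp C m g)) = comp C s1 (comp C \<sigma> (comp C n g))"
      using comp_assoc[OF mg \<rho> r1] comp_assoc[OF ng \<sigma> s1] comp_assoc[OF g m aM]
        comp_assoc[OF g n aN] sq3 by simp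
    \<comment> \<open>Now \<open>a R 0\<close> and \<open>a S 0\<close>, so \<open>a\<close> lies in
      both zero classes.\<close>
    obtain x' where x': "x' \<in> Hom C W X" "comp C k x' = comp C r1 (comp C \<rho> (comp C m g))"
      using Rcls[OF \<rho>g r2g] by blast
    obtain y' where y': "y' \<in> Hom C W Y" "comp C l y' = comp C s1 (comp C \<sigma> (comp C n g))"
      using Scls[OF \<sigma>g s2g] by blast
    have p: "p \<in> Hom C (Dom C p) X"
      using assms(7) kl unfolding is_pullback_def by auto
    \<comment> \<open>\<open>x'\<close> and \<open>y'\<close> have the same image \<open>a\<close>
      in \<open>A\<close>, so they factor through the pullback of \<open>k\<close> and
      \<open>l\<close>, a zero object. Hence \<open>x'\<close>, and with it \<open>a\<close>,
      vanishes.\<close>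
    obtain h where h: "h \<in> Hom C W (Dom C p)" "comp C p h = x'"
      using assms(7) x' y' same kl unfolding is_pullback_def by metis
    have "x' = zero_mor C W X"
      using zero_mor_eq[OF assms(8) h(1) p] h(2) by simp
    then have r1g: "comp C r1 (comp C \<rho> (comp C m g)) = zero_mor C W A"
      using x'(2) comp_zero[OF _ k] WD by simp
    note zR = zero_closed[of W R] and zS = zero_closed[of W S]
    \<comment> \<open>An element of a relation is determined by its two components, both zero here;
      the pullbacks \<open>M\<close>, \<open>N\<close> and \<open>D\<close> then carry this back to
      \<open>g\<close>.\<close>
    have \<rho>0: "comp C \<rho> (comp C m g) = zero_mor C W R"
      using Rmono[OF \<rho>g zR] r1g r2g comp_zero[OF _ r1] comp_zero[OF _ r2] WD HomD[OF r1] by simp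
    have \<sigma>0: "comp C \<sigma> (comp C n g) = zero_mor C W S"
      using Smono[OF \<sigma>g zS] r1g same s2g comp_zero[OF _ s1] comp_zero[OF _ s2] WD HomD[OF s1]
      by simp
    have m0: "comp C m g = zero_mor C W M"
      using pullback_ext[OF pb1, folded M_def, OF mg zero_closed] yg \<rho>0 comp_zero[OF _ y]
        comp_zero[OF _ \<rho>] WD HomD[OF y] by simp
    have n0: "comp C n g = zero_mor C W N"
      using pullback_ext[OF pb2, folded N_def, OF ng zero_closed] xg \<sigma>0 comp_zero[OF _ x]
        comp_zero[OF _ \<sigma>] WD HomD[OF x] by simp
    show ?thesis
      using pullback_ext[OF pb3, folded D_def, OF g zero_closed] m0 n0 comp_zero[OF _ m]
        comp_zero[OF _ n] WD by simp
  qed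
  obtain n' where "is_kernel C j n'" "zero_object C (Dom C n')"
    using zero_kernel[OF j(1) triv] by blast
  then have monic: "monic C j" using assms(2) by blast

  \<comment> \<open>Lifting the injections and splitting \<open>j\<close>\<close>
  have XY: "X \<in> Ob C" "Y \<in> Ob C" "A \<in> Ob C" using kl by auto
  note i1 = inj1[OF prod XY(1,2)] and i2 = inj2[OF prod XY(1,2)]
  note zYX = zero_closed[OF XY(2,1)] and zXY = zero_closed[OF XY(1,2)]
  note dl = comp_closed[OF l d(1)] and ek = comp_closed[OF k e(1)]
  have dl12: "comp C r1 (comp C d l) = l" "comp C r2 (comp C d l) = l"
    using comp_assoc[OF l d(1) r1] comp_assoc[OF l d(1) r2] d ident_left[OF l] by auto
  have ek12: "comp C s1 (comp C e k) = k" "comp C s2 (comp C e k) = k"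
    using comp_assoc[OF k e(1) s1] comp_assoc[OF k e(1) s2] e ident_left[OF k] by auto
  \<comment> \<open>\<open>uM\<close> uses the pair \<open>(x, 0)\<close> in \<open>R\<close>, and
    \<open>uN\<close> the diagonal pair \<open>(x, x)\<close> in \<open>S\<close>, supplied by
    reflexivity. Together they form \<open>(x, 0, x)\<close>.\<close>
  obtain uM where uM: "uM \<in> Hom C X M" "comp C y uM = zero_mor C X Y" "comp C \<rho> uM = \<kappa>"
    using into_M[OF zXY \<kappa>(1)] \<kappa>(3) comp_zero[OF XY(1) l] by auto
  obtain uN where uN: "uN \<in> Hom C X N" "comp C x uN = ident C X" "comp C \<sigma> uN = comp C e k"
    using into_N[OF ident_closed[OF XY(1)] ek] ek12 ident_right[OF k] by auto
  \<comment> \<open>Symmetrically, \<open>(y, y)\<close> in \<open>R\<close> and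
    \<open>(y, 0)\<close> in \<open>S\<close> form \<open>(0, y, y)\<close>.\<close>
  obtain vM where vM: "vM \<in> Hom C Y M" "comp C y vM = ident C Y" "comp C \<rho> vM = comp C d l"
    using into_M[OF ident_closed[OF XY(2)] dl] dl12 ident_right[OF l] by auto
  obtain vN where vN: "vN \<in> Hom C Y N" "comp C x vN = zero_mor C Y X" "comp C \<sigma> vN = \<mu>"
    using into_N[OF zYX \<mu>(1)] \<mu>(3) comp_zero[OF XY(2) k] by auto
  have au: "comp C (comp C r1 \<rho>) uM = k" "comp C (comp C s1 \<sigma>) uN = k"
    using comp_assoc[OF uM(1) \<rho> r1] comp_assoc[OF uN(1) \<sigma> s1] uM uN \<kappa> ek12 by auto
  have av: "comp C (comp C r1 \<rho>) vM = l" "comp C (comp C s1 \<sigma>) vN = l"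
    using comp_assoc[OF vM(1) \<rho> r1] comp_assoc[OF vN(1) \<sigma> s1] vM vN \<mu> dl12 by auto
  obtain u where u: "u \<in> Hom C X D" "comp C m u = uM" "comp C n u = uN"
    using into_D[OF uM(1) uN(1)] au by auto
  obtain v where v: "v \<in> Hom C Y D" "comp C m v = vM" "comp C n v = vN"
    using into_D[OF vM(1) vN(1)] av by auto
  have ju: "comp C j u = inj1 C X Y p1 p2"
    by (rule product_ext[OF prod comp_closed[OF u(1) j(1)] i1(1)])
      (use comp_assoc[OF u(1) j(1) p1] comp_assoc[OF u(1) j(1) p2] comp_assoc[OF u(1) n x]
        comp_assoc[OF u(1) m y] i1 u uM uN j in auto)
  have jv: "comp C j v = inj2 C X Y p1 p2"
    by (rule product_ext[OF prod comp_closed[OF v(1) j(1)] i2(1)])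
      (use comp_assoc[OF v(1) j(1) p1] comp_assoc[OF v(1) j(1) p2] comp_assoc[OF v(1) n x]
        comp_assoc[OF v(1) m y] i2 v vM vN j in auto)
  have P: "P \<in> Ob C" using HomD[OF p1] by auto
  note idP = ident_closed[OF P]
  have "jointly_strongly_epic C (inj1 C X Y p1 p2) (inj2 C X Y p1 p2)"
    using assms(1) XY prod unfolding unital_def by blast
  then have diag: "\<exists>d\<in>Hom C P D. comp C j d = h"
    if "h \<in> Hom C P P" "comp C j u = comp C h (inj1 C X Y p1 p2)"
      "comp C j v = comp C h (inj2 C X Y p1 p2)" for h
    using that monic u(1) v(1) HomD[OF i1(1)] HomD[OF i2(1)] HomD[OF j(1)]
    unfolding jointly_strongly_epic_def by metis
  \<comment> \<open>The diagonal property is applied to the monomorphism \<open>j\<close> and the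
    identity of \<open>P\<close>, so the diagonal is a section of \<open>j\<close>.\<close>
  obtain t where t: "t \<in> Hom C P D" "comp C j t = ident C P"
    using diag[OF idP] ju jv ident_left[OF i1(1)] ident_left[OF i2(1)] by auto
  \<comment> \<open>Cancelling \<open>j\<close> shows that \<open>t\<close> restricts to
    \<open>u\<close> and \<open>v\<close> along the injections.\<close>
  have jmono: "f = g" if "f \<in> Hom C W D" "g \<in> Hom C W D" "comp C j f = comp C j g" for W f g
    using monic that HomD[OF j(1)] unfolding monic_def by blast
  have ti1: "comp C t (inj1 C X Y p1 p2) = u"
    by (rule jmono[OF comp_closed[OF i1(1) t(1)] u(1)])
      (use comp_assoc[OF i1(1) t(1) j(1)] t ju ident_left[OF i1(1)] in simp)
  have ti2: "comp C t (inj2 C X Y p1 p2) = v"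
    by (rule jmono[OF comp_closed[OF i2(1) t(1)] v(1)])
      (use comp_assoc[OF i2(1) t(1) j(1)] t jv ident_left[OF i2(1)] in simp)
  note a = comp_closed[OF m aM]
  \<comment> \<open>The component \<open>a\<close> of the section; on \<open>u\<close> it is
    \<open>k\<close> and on \<open>v\<close> it is \<open>l\<close>.\<close>
  define \<phi> where "\<phi> = comp C (comp C (comp C r1 \<rho>) m) t"
  have "\<phi> \<in> Hom C P A" unfolding \<phi>_def using comp_closed[OF t(1) a] .
  moreover have "comp C \<phi> (inj1 C X Y p1 p2) = k"
    unfolding \<phi>_def using comp_assoc[OF i1(1) t(1) a] ti1 comp_assoc[OF u(1) m aM] u au by simp
  moreover have "comp C \<phi> (inj2 C X Y p1 p2) = l"
    unfolding \<phi>_def using comp_assoc[OF i2(1) t(1) a] ti2 comp_assoc[OF v(1) m aM] v av by simp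
  ultimately show ?thesis
    using prod kl unfolding huq_commute_def by auto
qed

end
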